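(* For every $\delta\in[0,1]$, $$C_{\mathrm{ins}}(\delta) = (1+\delta)\left(1-h\left(\frac{\delta}{1+\delta}\right)\right).$$ More precisely, fix $\delta\in[0,1]$. For any $\varepsilon>0$ and any block length $n$ there exists a code $\mathcal{C}\subseteq\{0,1\}^n$ of rate $C_{\mathrm{ins}}(\delta)-\varepsilon$ that is $(\delta,L)$-list-decodable from insertions with $L=O(1/\varepsilon)$ (the implied constant does not depend on $n$ or $\varepsilon$), while for any $\varepsilon>0$ and all sufficiently large $n$, any code $\mathcal{C}\subseteq\{0,1\}^n$ of rate $C_{\mathrm{ins}}(\delta)+\varepsilon$ is not $(\delta,L)$-list-decodable from insertions with $L=2^{\varepsilon n/2}$.
   Context: $h(p)=-p\log p-(1-p)\log(1-p)$ is the binary entropy function, with $\log$ base $2$ and $h(0)=h(1)=0$. A string $x$ is a subsequence of $y$, written $x\preceq y$, if $x$ is obtained from $y$ by deleting some (possibly none) of its symbols; then $y$ is a supersequence of $x$. A code $\mathcal{C}\subseteq\{0,1\}^n$ has rate $R$ if $|\mathcal{C}|=2^{Rn}$, up to rounding to an integer; rates are understood to lie in $[0,1]$ (claims about codes with rate outside this range are vacuous). For simplicity $\delta n$ is assumed to be an integer (floors and ceilings do not matter). A code $\mathcal{C}\subseteq\{0,1\}^n$ is $(\delta,L)$-list-decodable from insertions if for every $y\in\{0,1\}^{(1+\delta)n}$ we have $|\{c\in\mathcal{C}: c\preceq y\}|\le L$. $C_{\mathrm{ins}}(\delta)$, the capacity of list-decoding from a $\delta$-fraction of insertions, is the largest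 real number such that for any rate $R<C_{\mathrm{ins}}(\delta)$ and all sufficiently large $n$ there exists a code $\mathcal{C}\subseteq\{0,1\}^n$ of rate at least $R$ that is $(\delta,L)$-list-decodable from insertions with list size $L=L(n)$ growing at most polynomially in $n$. *)

theory Defs
  imports Complex_Main "HOL-Library.Sublist" "HOL-Library.Landau_Symbols"
begin

(* The endpoint values are 0 because the undefined logarithm is multiplied by 0. *)
definition binary_entropy :: "real \<Rightarrow> real" where
  "binary_entropy p = - p * log 2 p - (1 - p) * log 2 (1 - p)"

definition binary_words :: "nat \<Rightarrow> bool list set" where
  "binary_words n = {x. length x = n}"

(* The size of the code is 2 powr (R * n) up to rounding: the last conjunct says exactly
   that card C is the floor or the ceiling of that number. *)
definition code_of_rate :: "nat \<Rightarrow> real \<Rightarrow> bool list set \<Rightarrow> bool" where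
  "code_of_rate n R C \<longleftrightarrow>
     C \<subseteq> binary_words n \<and> 0 \<le> R \<and> R \<le> 1 \<and> \<bar>real (card C) - 2 powr (R * real n)\<bar> < 1"

(* The list size is a real number since bounds such as 2 powr (\<epsilon> * n / 2) occur. When
   \<delta> * n is not an integer, the number of insertions is rounded down. *)
definition list_decodable_ins :: "nat \<Rightarrow> real \<Rightarrow> real \<Rightarrow> bool list set \<Rightarrow> bool" where
  "list_decodable_ins n \<delta> L C \<longleftrightarrow>
     (\<forall>y \<in> binary_words (nat \<lfloor>(1 + \<delta>) * real n\<rfloor>). real (card {c \<in> C. subseq c y}) \<le> L)"

definition achievable_ins :: "real \<Rightarrow> real \<Rightarrow> bool" where
  "achievable_ins \<delta> R \<longleftrightarrow>
     (\<exists>L :: nat \<Rightarrow> real. (\<exists>k. L \<in> O(\<lambda>n. real n ^ k)) \<and>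
        (\<forall>\<^sub>F n in sequentially.
           \<exists>C. (\<exists>R' \<ge> R. code_of_rate n R' C) \<and> list_decodable_ins n \<delta> (L n) C))"

(* R ranges over all reals. Negative R is harmless, being covered by codes of rate 0; allowing
   R > 1, for which no code exists, is what bounds the capacity by 1. *)
definition C_ins :: "real \<Rightarrow> real" where
  "C_ins \<delta> = (GREATEST c. \<forall>R < c. achievable_ins \<delta> R)"

end

theory Submission
  imports Defs "HOL-Real_Asymp.Real_Asymp"
begin

text \<open>
  Every word of length \<open>n\<close> has the same number of supersequences of length
  \<open>N = (1 + \<delta>) n\<close>, so averaging over all \<open>y\<close> gives the converse.

  For achievability, uniformly random codewords fail, because an alternating \<open>y\<close> has far too many
  subsequences. They are replaced by a stationary Markov chain that repeats its last letter with
  probability \<open>(1 + \<delta>) / 2\<close>. Insert before each letter of this chain a geometric number,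
  with parameter \<open>\<delta> / (1 + \<delta>)\<close>, of complements of that letter; the resulting sequence
  of letters is uniformly distributed, which forces every \<open>y\<close> of length \<open>N\<close> to contain the
  first \<open>n\<close> letters of the chain with probability at most \<open>2 powr (- C n) / (1 - \<delta>)\<close>, where
  \<open>C\<close> is the capacity. Codewords are then chosen one at a time so as to keep the potential
  \<open>\<Sum>y. (1 + \<beta>) ^ (list size at y)\<close> small, with \<open>\<beta> = 2 powr (\<epsilon> n)\<close>.
\<close>

subsection \<open>Binary words and supersequences\<close>

lemma finite_binary_words [simp]: "finite (binary_words n)"
  unfolding binary_words_def using finite_lists_length_eq[of "UNIV :: bool set" n] by simp

lemma card_binary_words: "card (binary_words n) = 2 ^ n"
  unfolding binary_words_def using card_lists_length_eq[of "UNIV :: bool set" n] by simp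

lemma binary_words_0 [simp]: "binary_words 0 = {[]}"
  by (auto simp: binary_words_def)

lemma binary_words_Suc:
  "binary_words (Suc n) = Cons True ` binary_words n \<union> Cons False ` binary_words n"
  by (auto simp: binary_words_def length_Suc_conv image_iff)

lemma sum_binary_words_Suc:
  fixes f :: "bool list \<Rightarrow> 'a :: comm_monoid_add"
  shows "(\<Sum>x\<in>binary_words (Suc n). f x) = (\<Sum>x\<in>binary_words n. f (True # x) + f (False # x))"
  unfolding binary_words_Suc
  by (subst sum.union_disjoint) (auto simp: sum.reindex sum.distrib)

lemma finite_subseqs [simp]: "finite {x. subseq x y}"
  by (metis List.finite_set set_subseqs_eq)

text \<open>Splitting on whether the first letter of \<open>y\<close> equals that of
  \<open>x\<close> gives Pascal's recurrence, whatever the letters are. For empty \<open>x\<close>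
  the count is \<open>2 ^ N\<close> instead of 1, whence only an inequality.\<close>

lemma choose_le_card_supersequences:
  "(N choose length x) \<le> card {y \<in> binary_words N. subseq x y}"
proof (induction N arbitrary: x)
  case 0
  show ?case by (cases x) auto
next
  case (Suc N)
  show ?case
  proof (cases x)
    case Nil
    then show ?thesis by (simp add: card_binary_words)
  next
    case (Cons c x')
    let ?A = "{y \<in> binary_words N. subseq x' y}" and ?B = "{y \<in> binary_words N. subseq x y}"
    have eq: "{y \<in> binary_words (Suc N). subseq x y} = Cons c ` ?A \<union> Cons (\<not> c) ` ?B"
      unfolding binary_words_Suc Cons by (cases c) auto
    have "card {y \<in> binary_words (Suc N). subseq x y} = card ?A + card ?B"
      unfolding eq by (subst card_Un_disjoint) (auto simp: card_image)
    then show ?thesis using Suc.IH[of x'] Suc.IH[of x] Cons by simp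
  qed
qed

text \<open>The largest term of the expansion of \<open>(d + n) ^ (d + n)\<close> is the one with index \<open>d\<close>.\<close>

lemma choose_ge_entropy:
  fixes d n :: nat
  shows "(d + n) ^ (d + n) \<le> (d + n + 1) * (((d + n) choose d) * d ^ d * n ^ n)"
proof -
  define N where "N = d + n"
  define a where "a j = (N choose j) * d ^ j * n ^ (N - j)" for j
  \<comment> \<open>The ratio of consecutive terms with denominators cleared: it is at least 1 for
    \<open>j < d\<close> and at most 1 from \<open>d\<close> on.\<close>
  have step: "a (Suc j) * (Suc j * n) = a j * ((N - j) * d)" if "j < N" for j
  proof -
    have "n ^ (N - j) = n * n ^ (N - Suc j)"
      using that by (metis Suc_diff_Suc power_Suc)
    moreover have "(N choose Suc j) * Suc j = (N choose j) * (N - j)"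
      using binomial_absorption[of j N] binomial_absorb_comp[of N j] by (simp add: mult.commute)
    ultimately show ?thesis unfolding a_def by (simp only: power_Suc mult_ac) (metis mult.assoc mult.commute)
  qed
  have up: "a j \<le> a (Suc j)" if "j < d" "n > 0" for j
  proof -
    have "Suc j * n \<le> (N - j) * d"
      using that mult_le_mono[of "Suc j" d n "N - j"] by (simp add: N_def mult.commute)
    then have "a j * (Suc j * n) \<le> a (Suc j) * (Suc j * n)"
      using step[of j] that by (simp add: N_def)
    then show ?thesis using that by simp
  qed
  have down: "a (Suc j) \<le> a j" if "d \<le> j" "j < N" for j
  proof -
    have "n > 0" using that by (simp add: N_def)
    have "(N - j) * d \<le> Suc j * n"
      using that mult_le_mono[of "N - j" n d "Suc j"] by (simp add: N_def mult.commute)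
    then have "a (Suc j) * (Suc j * n) \<le> a j * (Suc j * n)"
      using step[of j] that by simp
    then show ?thesis using \<open>n > 0\<close> by simp
  qed
  have max: "a j \<le> a d" if "j \<le> N" for j
  proof (cases "j \<le> d")
    case True
    then show ?thesis
    \<comment> \<open>For \<open>n = 0\<close> the factor \<open>Suc j * n\<close> cannot be
      cancelled, but then \<open>N = d\<close> and \<open>0 ^ (N - j)\<close> kills every term with
      \<open>j < d\<close>.\<close>
    proof (cases "n = 0")
      case True
      then show ?thesis using that \<open>j \<le> d\<close> by (cases "j = d") (auto simp: a_def N_def power_0_left)
    next
      case False
      from True show ?thesis
        by (induction j rule: inc_induct) (use up False in \<open>auto intro: order_trans\<close>)
    qed
  next
    case False
    then have "d \<le> j" by simp
    then show ?thesis using that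
      by (induction j rule: dec_induct) (use down in \<open>auto intro: order_trans simp: Suc_le_eq\<close>)
  qed
  have "N ^ N = (\<Sum>j\<le>N. a j)"
    unfolding a_def using binomial_ring[of d n N] by (simp add: N_def)
  also have "\<dots> \<le> (\<Sum>j\<le>N. a d)" by (rule sum_mono) (use max in auto)
  finally show ?thesis by (simp add: a_def N_def algebra_simps)
qed

subsection \<open>The capacity function\<close>

text \<open>This is (1 + u) h(u / (1 + u)), the exponential growth rate in n of the binomial
  coefficient of (1 + u) n over u n.\<close>

definition ins_entropy :: "real \<Rightarrow> real" where
  "ins_entropy u = (1 + u) * log 2 (1 + u) - u * log 2 u"

lemma capacity_eq:
  assumes "0 \<le> \<delta>"
  shows "(1 + \<delta>) * (1 - binary_entropy (\<delta> / (1 + \<delta>))) = 1 + \<delta> - ins_entropy \<delta>"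
proof -
  have *: "1 - \<delta> / (1 + \<delta>) = 1 / (1 + \<delta>)" using assms by (simp add: field_simps)
  have "\<delta> * log 2 (\<delta> / (1 + \<delta>)) = \<delta> * (log 2 \<delta> - log 2 (1 + \<delta>))"
    using assms by (cases "\<delta> = 0") (auto simp: log_divide)
  moreover have "log 2 (1 / (1 + \<delta>)) = - log 2 (1 + \<delta>)"
    using assms by (simp add: log_divide)
  moreover have "(1 + \<delta>) * binary_entropy (\<delta> / (1 + \<delta>))
     = - (\<delta> * log 2 (\<delta> / (1 + \<delta>))) - log 2 (1 / (1 + \<delta>))"
  proof -
    have "c * (- (\<delta> / c) * a - 1 / c * b) = - (\<delta> * a) - b" if "c \<noteq> 0" for a b c :: real
      using that by (simp add: right_diff_distrib)
    then show ?thesis unfolding binary_entropy_def * using assms by simp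
  qed
  ultimately show ?thesis by (simp add: ins_entropy_def algebra_simps)
qed

text \<open>From \<open>2 * \<delta> \<le> 1 + \<delta>\<close> the logarithm of
  \<open>(1 + \<delta>) / \<delta>\<close> is at least 1. Consequently the capacity is at most 1, so
  rates below it are admissible.\<close>

lemma ins_entropy_ge:
  assumes "0 \<le> \<delta>" "\<delta> \<le> 1"
  shows "\<delta> \<le> ins_entropy \<delta>"
proof (cases "\<delta> = 0")
  case False
  then have d: "\<delta> > 0" using assms by simp
  have "log 2 (2 * \<delta>) \<le> log 2 (1 + \<delta>)" using assms d by simp
  then have "1 \<le> log 2 (1 + \<delta>) - log 2 \<delta>" using d by (simp add: log_mult)
  from mult_left_mono[OF this, of \<delta>] have "\<delta> \<le> \<delta> * log 2 (1 + \<delta>) - \<delta> * log 2 \<delta>"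
    using d by (simp add: algebra_simps)
  moreover have "log 2 (1 + \<delta>) \<ge> 0" using d by simp
  ultimately show ?thesis by (simp add: ins_entropy_def algebra_simps)
qed (simp add: ins_entropy_def)

lemma choose_ge_ins_entropy:
  fixes d n :: nat
  assumes "n > 0"
  shows "2 powr (real n * ins_entropy (d / n)) / (d + n + 1) \<le> real ((d + n) choose d)"
proof -
  have pw: "real k ^ k = 2 powr (real k * log 2 k)" for k :: nat
    by (cases "k = 0") (auto simp: powr_realpow[symmetric] powr_powr[symmetric] mult.commute[of _ "log _ _"])
  have e: "1 + real d / n = (d + n) / n" using assms by (simp add: field_simps)
  have "real n * ins_entropy (d / n)
      = real (d + n) * log 2 ((d + n) / n) - d * log 2 (d / n)"
    unfolding ins_entropy_def e using assms by (simp add: field_simps)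
  also have "\<dots> = real (d + n) * log 2 (d + n) - d * log 2 d - n * log 2 n"
    using assms by (cases "d = 0") (auto simp: log_divide algebra_simps)
  finally have eq: "2 powr (real n * ins_entropy (d / n)) = real (d + n) ^ (d + n) / (d ^ d * n ^ n)"
    by (simp add: powr_diff pw del: of_nat_add)
  have pos: "0 < real d ^ d * real n ^ n" using assms by (cases "d = 0") auto
  have "real ((d + n) ^ (d + n)) \<le> real ((d + n + 1) * (((d + n) choose d) * d ^ d * n ^ n))"
    using choose_ge_entropy[of d n] by (subst of_nat_le_iff)
  then have "2 powr (real n * ins_entropy (d / n)) \<le> real (d + n + 1) * real ((d + n) choose d)"
    unfolding eq using pos by (simp add: pos_divide_le_eq algebra_simps)
  then show ?thesis by (subst pos_divide_le_eq) (auto simp: mult.commute)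
qed

subsection \<open>The converse\<close>

lemma nat_floor_block:
  assumes "0 \<le> \<delta>"
  shows "nat \<lfloor>(1 + \<delta>) * real n\<rfloor> = nat \<lfloor>\<delta> * real n\<rfloor> + n"
proof -
  have "\<lfloor>(1 + \<delta>) * real n\<rfloor> = \<lfloor>\<delta> * real n\<rfloor> + int n"
    using floor_add_int[of "\<delta> * real n" "int n"] by (simp add: algebra_simps)
  then show ?thesis using assms by (simp add: nat_add_distrib)
qed

lemma ins_entropy_floor_tendsto:
  assumes "0 \<le> \<delta>"
  shows "(\<lambda>n. ins_entropy (nat \<lfloor>\<delta> * real n\<rfloor> / real n)) \<longlonglongrightarrow> ins_entropy \<delta>"
\<comment> \<open>\<open>log 2\<close> is not continuous at 0, but for \<open>\<delta> = 0\<close>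
  the sequence is constant.\<close>
proof (cases "\<delta> = 0")
  case False
  then have d: "\<delta> > 0" using assms by simp
  have 1: "(\<lambda>n. nat \<lfloor>\<delta> * real n\<rfloor> / real n) \<longlonglongrightarrow> \<delta>"
  proof (rule tendsto_sandwich)
    show "\<forall>\<^sub>F n in sequentially. \<delta> - 1 / real n \<le> nat \<lfloor>\<delta> * real n\<rfloor> / real n"
      using eventually_gt_at_top[of 0]
    proof eventually_elim
      case (elim n)
      have "\<delta> * n - 1 \<le> nat \<lfloor>\<delta> * real n\<rfloor>" by linarith
      from divide_right_mono[OF this, of "real n"] show ?case
        using elim by (simp add: diff_divide_distrib)
    qed
    show "\<forall>\<^sub>F n in sequentially. nat \<lfloor>\<delta> * real n\<rfloor> / real n \<le> \<delta>"
      using eventually_gt_at_top[of 0]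
    proof eventually_elim
      case (elim n)
      have "nat \<lfloor>\<delta> * real n\<rfloor> \<le> \<delta> * n" using assms by (simp add: of_nat_nat)
      then show ?case using elim by (simp add: field_simps)
    qed
    show "(\<lambda>n. \<delta> - 1 / real n) \<longlonglongrightarrow> \<delta>" by real_asymp
  qed auto
  show ?thesis unfolding ins_entropy_def
    by (intro tendsto_intros 1) (use d in auto)
qed simp

text \<open>Double counting of the pairs of a codeword and a supersequence of length
  \<open>N\<close>: each codeword lies in at least \<open>N choose n\<close> words, so the average
  list has size about \<open>2 powr (\<epsilon> * n)\<close>. The bound on \<open>card C\<close> is
  halved to absorb the rounding of code sizes.\<close>

lemma converse_ins:
  assumes "0 \<le> \<delta>" "\<delta> \<le> 1" "\<epsilon> > 0"
  shows "\<forall>\<^sub>F n in sequentially. \<forall>C. C \<subseteq> binary_words n \<and>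
           2 powr ((1 + \<delta> - ins_entropy \<delta> + \<epsilon>) * n) / 2 \<le> card C \<longrightarrow>
           \<not> list_decodable_ins n \<delta> (2 powr (\<epsilon> * real n / 2)) C"
proof -
  \<comment> \<open>Of the surplus \<epsilon>/2 in the exponent, one \<epsilon>/4 pays for replacing
    \<delta> by its rounded value d/n, the other for the polynomial factor
    \<open>2 * (N + 1)\<close>.\<close>
  have "\<forall>\<^sub>F n in sequentially. ins_entropy (nat \<lfloor>\<delta> * real n\<rfloor> / real n) > ins_entropy \<delta> - \<epsilon> / 4"
    using order_tendstoD(1)[OF ins_entropy_floor_tendsto[OF assms(1)]] assms(3) by simp
  moreover have "\<forall>\<^sub>F n in sequentially. 2 * (2 * real n + 1) < 2 powr (\<epsilon> / 4 * real n)"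
    using assms(3) by real_asymp
  ultimately show ?thesis using eventually_gt_at_top[of 0]
  proof eventually_elim
    case (elim n)
    define d where "d = nat \<lfloor>\<delta> * real n\<rfloor>"
    define N where "N = d + n"
    have N_eq: "nat \<lfloor>(1 + \<delta>) * real n\<rfloor> = N"
      using nat_floor_block[OF assms(1)] by (simp add: N_def d_def)
    have d_le: "d \<le> \<delta> * n" using assms(1) unfolding d_def by (simp add: of_nat_nat)
    then have N_le: "N \<le> (1 + \<delta>) * n" by (simp add: N_def algebra_simps)
    have "\<delta> * n \<le> n" using mult_right_mono[OF assms(2), of "real n"] by simp
    then have N2: "N + 1 \<le> 2 * real n + 1" using d_le by (simp add: N_def)
    show ?case
    proof (intro allI impI notI, elim conjE)
      fix C assume C: "C \<subseteq> binary_words n" "list_decodable_ins n \<delta> (2 powr (\<epsilon> * real n / 2)) C"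
        and card: "2 powr ((1 + \<delta> - ins_entropy \<delta> + \<epsilon>) * n) / 2 \<le> card C"
      have fin: "finite C" using C(1) finite_subset finite_binary_words by blast
      have "real (card C) * (N choose n) = (\<Sum>c\<in>C. N choose length c)"
        using C(1) by (simp add: binary_words_def subset_eq)
      also have "\<dots> \<le> (\<Sum>c\<in>C. card {y \<in> binary_words N. subseq c y})"
        by (intro of_nat_mono sum_mono choose_le_card_supersequences)
      also have "(\<Sum>c\<in>C. card {y \<in> binary_words N. subseq c y})
               = (\<Sum>y\<in>binary_words N. card {c \<in> C. subseq c y})"
        by (rule sum_multicount_gen) (use fin in auto)
      also have "real \<dots> \<le> (\<Sum>y\<in>binary_words N. 2 powr (\<epsilon> * real n / 2))"
        using C(2) unfolding list_decodable_ins_def N_eq of_nat_sum by (intro sum_mono) auto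
      also have "\<dots> = 2 powr N * 2 powr (\<epsilon> * real n / 2)"
        by (simp add: card_binary_words powr_realpow)
      also have "\<dots> \<le> 2 powr ((1 + \<delta>) * n) * 2 powr (\<epsilon> * real n / 2)"
        using N_le by (intro mult_right_mono powr_mono) auto
      finally have A: "real (card C) * (N choose n) \<le> 2 powr ((1 + \<delta>) * n) * 2 powr (\<epsilon> * real n / 2)" .
      have "(ins_entropy \<delta> - \<epsilon> / 4) * n \<le> real n * ins_entropy (d / n)"
        using elim unfolding d_def by (simp add: mult.commute)
      then have "2 powr ((ins_entropy \<delta> - \<epsilon> / 4) * n) / (N + 1) \<le> 2 powr (real n * ins_entropy (d / n)) / (N + 1)"
        by (intro divide_right_mono powr_mono) auto
      also have "\<dots> \<le> (N choose n)"
        using choose_ge_ins_entropy[of n d] elim binomial_symmetric[of d N] by (simp add: N_def)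
      finally have "(2 powr ((1 + \<delta> - ins_entropy \<delta> + \<epsilon>) * n) / 2) *
          (2 powr ((ins_entropy \<delta> - \<epsilon> / 4) * n) / (N + 1)) \<le> real (card C) * (N choose n)"
        using card by (intro mult_mono) auto
      also note A
      also have "2 powr ((1 + \<delta> - ins_entropy \<delta> + \<epsilon>) * n) / 2 * (2 powr ((ins_entropy \<delta> - \<epsilon> / 4) * n) / (N + 1))
         = 2 powr ((1 + \<delta>) * n) * 2 powr (\<epsilon> * real n / 2) * 2 powr (\<epsilon> / 4 * real n) / (2 * (N + 1))"
        by (simp add: powr_add[symmetric] algebra_simps)
      finally have "2 powr ((1 + \<delta>) * n) * 2 powr (\<epsilon> * real n / 2) * 2 powr (\<epsilon> / 4 * real n) \<le>
          2 powr ((1 + \<delta>) * n) * 2 powr (\<epsilon> * real n / 2) * (2 * (N + 1))"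
        by (simp add: field_simps)
      then have "2 powr (\<epsilon> / 4 * real n) \<le> 2 * (real N + 1)"
        by (simp add: mult_le_cancel_left_pos)
      then show False using elim N2 by simp
    qed
  qed
qed

text \<open>Since \<open>2 powr (R * n)\<close> is at least 1 and the rounding error is below 1, the
  code is nonempty; a positive integer exceeding x - 1 is at least x / 2.\<close>

lemma code_of_rate_card_ge:
  assumes "code_of_rate n R C" "R' \<le> R"
  shows "2 powr (R' * n) / 2 \<le> card C"
proof -
  from assms(1) have R: "0 \<le> R" and c: "\<bar>real (card C) - 2 powr (R * real n)\<bar> < 1"
    by (auto simp: code_of_rate_def)
  have "2 powr (R * n) \<ge> 1" using R by (simp add: ge_one_powr_ge_zero)
  with c have "card C > 0" by linarith
  with c have "2 powr (R * n) / 2 \<le> card C" by linarith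
  moreover have "2 powr (R' * n) \<le> 2 powr (R * n)"
    using assms(2) by (intro powr_mono mult_right_mono) auto
  ultimately show ?thesis by linarith
qed

subsection \<open>A Markov measure on binary words\<close>

text \<open>The stationary law of the chain, with uniform single letters. Being a product over
  adjacent pairs, it is invariant under reversal, so the chain may be grown by prepending
  letters.\<close>

fun markov :: "real \<Rightarrow> bool list \<Rightarrow> real" where
  "markov s [] = 1"
| "markov s [a] = 1 / 2"
| "markov s (a # b # x) = (if a = b then s else 1 - s) * markov s (b # x)"

lemma markov_nonneg:
  assumes "0 \<le> s" "s \<le> 1"
  shows "0 \<le> markov s x"
  by (induction x rule: induct_list012) (use assms in auto)

text \<open>No single word is too likely; this bounds the total mass of the codewords that the
  greedy selection has already used up.\<close>

lemma markov_le_power: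
  assumes "1 / 2 \<le> s" "s \<le> 1"
  shows "markov s x \<le> s ^ length x"
proof (induction x rule: induct_list012)
  case (3 a b x)
  have "markov s (a # b # x) \<le> s * s ^ length (b # x)"
    unfolding markov.simps using 3 assms by (intro mult_mono) (auto intro: markov_nonneg)
  then show ?case by simp
qed (use assms in auto)

lemma markov_Cons_sum: "markov s (True # x) + markov s (False # x) = markov s x"
  by (cases x) (auto simp: algebra_simps)

lemma sum_markov: "sum (markov s) (binary_words n) = 1"
  by (induction n) (auto simp: sum_binary_words_Suc markov_Cons_sum)

text \<open>
  A word \<open>x\<close> whose greedy embedding occupies exactly \<open>m\<close> letters is, up to a factor depending on
  \<open>m\<close> only, turned into these letters by the insertion process with probability
  proportional to \<open>(1 / \<delta>) ^ length x\<close>.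
\<close>

definition markov_weight :: "real \<Rightarrow> bool list \<Rightarrow> real" where
  "markov_weight \<delta> x = markov ((1 + \<delta>) / 2) x / \<delta> ^ length x"

text \<open>
  Since reversal preserves both the Markov measure and the subsequence relation, embeddings are
  made greedy from the right: this set consists of the words whose rightmost embedding into
  \<open>a # w\<close> uses the first letter.
\<close>

definition new_subseqs :: "bool \<Rightarrow> bool list \<Rightarrow> bool list set" where
  "new_subseqs a w = {x. subseq x (a # w) \<and> \<not> subseq x w}"

lemma finite_new_subseqs [simp]: "finite (new_subseqs a w)"
  unfolding new_subseqs_def by (rule finite_subset[OF _ finite_subseqs[of "a # w"]]) auto

lemma new_subseqs_hd: "x \<in> new_subseqs a w \<Longrightarrow> \<exists>x'. x = a # x'"
  by (cases x) (auto simp: new_subseqs_def split: if_splits)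

text \<open>If \<open>a # x'\<close> does not embed into \<open>a # w\<close>, then
  \<open>x'\<close> does not embed into \<open>w\<close>.\<close>

lemma new_subseqs_same: "new_subseqs a (a # w) \<subseteq> Cons a ` new_subseqs a w"
proof
  fix x assume x: "x \<in> new_subseqs a (a # w)"
  with new_subseqs_hd obtain x' where "x = a # x'" by blast
  then show "x \<in> Cons a ` new_subseqs a w" using x by (auto simp: new_subseqs_def)
qed

text \<open>Write the word as \<open>a # x'\<close>. If \<open>x'\<close> needs the letter
  \<open>b\<close>, it is new for \<open>b # w\<close>; otherwise \<open>b\<close> is skipped and
  the leading \<open>a\<close> acts as if it stood directly before \<open>w\<close>.\<close>

lemma new_subseqs_diff:
  assumes "a \<noteq> b"
  shows "new_subseqs a (b # w) \<subseteq> Cons a ` new_subseqs b w \<union> new_subseqs a w"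
proof
  fix x assume x: "x \<in> new_subseqs a (b # w)"
  with new_subseqs_hd obtain x' where "x = a # x'" by blast
  then show "x \<in> Cons a ` new_subseqs b w \<union> new_subseqs a w"
    using x assms by (auto simp: new_subseqs_def)
qed

lemma markov_weight_nonneg:
  assumes "0 < \<delta>" "\<delta> < 1"
  shows "0 \<le> markov_weight \<delta> x"
  unfolding markov_weight_def using assms by (intro divide_nonneg_nonneg markov_nonneg) auto

text \<open>All words of \<open>new_subseqs b w\<close> start with \<open>b\<close>, so prepending
  \<open>a\<close> costs the same transition factor for each of them.\<close>

lemma markov_weight_Cons_new:
  assumes "x \<in> new_subseqs b w"
  shows "markov_weight \<delta> (a # x) =
    (if a = b then (1 + \<delta>) / (2 * \<delta>) else (1 - \<delta>) / (2 * \<delta>)) * markov_weight \<delta> x"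
proof -
  obtain x' where "x = b # x'" using new_subseqs_hd[OF assms] by blast
  then show ?thesis by (auto simp: markov_weight_def field_simps)
qed

text \<open>The repetition probability s = (1 + \<delta>) / 2 solves s / \<delta> = (1 - s) /
  \<delta> + 1. Hence an equal and a different next letter give the same growth factor,
  \<open>g\<close> and \<open>h + 1\<close> respectively, and the bound depends only on the length
  of \<open>w\<close>.\<close>

lemma sum_markov_weight_new_subseqs:
  assumes "0 < \<delta>" "\<delta> < 1"
  shows "sum (markov_weight \<delta>) (new_subseqs a w) \<le> ((1 + \<delta>) / (2 * \<delta>)) ^ Suc (length w) / (1 + \<delta>)"
proof (induction w arbitrary: a)
  case Nil
  have "x = [a]" if "x \<in> new_subseqs a []" for x
  proof -
    from new_subseqs_hd[OF that] obtain x' where "x = a # x'" by blast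
    then show ?thesis using that by (simp add: new_subseqs_def)
  qed
  then have "new_subseqs a [] \<subseteq> {[a]}" by blast
  then have "sum (markov_weight \<delta>) (new_subseqs a []) \<le> sum (markov_weight \<delta>) {[a]}"
    using markov_weight_nonneg[OF assms] by (intro sum_mono2) auto
  also have "\<dots> = 1 / (2 * \<delta>)" by (simp add: markov_weight_def)
  also have "\<dots> = ((1 + \<delta>) / (2 * \<delta>)) ^ Suc (length []) / (1 + \<delta>)" using assms by simp
  finally show ?case .
next
  case (Cons b w)
  note nn = markov_weight_nonneg[OF assms]
  define g where "g = (1 + \<delta>) / (2 * \<delta>)"
  define h where "h = (1 - \<delta>) / (2 * \<delta>)"
  have gh: "g = h + 1" "0 \<le> h" using assms by (auto simp: g_def h_def field_simps)
  define B where "B = g ^ Suc (length w) / (1 + \<delta>)"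
  have IH: "sum (markov_weight \<delta>) (new_subseqs c w) \<le> B" for c
    using Cons.IH unfolding B_def g_def .
  have step: "sum (markov_weight \<delta>) (Cons a ` new_subseqs b w)
      = (if a = b then g else h) * sum (markov_weight \<delta>) (new_subseqs b w)"
    by (simp add: sum.reindex markov_weight_Cons_new sum_distrib_left g_def h_def)
  have "sum (markov_weight \<delta>) (new_subseqs a (b # w)) \<le> g * B"
  proof (cases "a = b")
    case True
    have "sum (markov_weight \<delta>) (new_subseqs a (b # w))
        \<le> sum (markov_weight \<delta>) (Cons a ` new_subseqs b w)"
      using new_subseqs_same[of a w] True nn by (intro sum_mono2) auto
    also have "\<dots> \<le> g * B" unfolding step using True IH gh by (auto intro: mult_left_mono)
    finally show ?thesis .
  next
    case False
    have "sum (markov_weight \<delta>) (new_subseqs a (b # w))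
        \<le> sum (markov_weight \<delta>) (Cons a ` new_subseqs b w \<union> new_subseqs a w)"
      using new_subseqs_diff[OF False] nn by (intro sum_mono2) auto
    also have "\<dots> \<le> sum (markov_weight \<delta>) (Cons a ` new_subseqs b w)
        + sum (markov_weight \<delta>) (new_subseqs a w)"
      using nn by (subst sum_Un) (auto intro: sum_nonneg)
    also have "\<dots> \<le> h * B + B"
      unfolding step using False IH gh by (auto intro!: add_mono mult_left_mono)
    finally show ?thesis by (simp add: gh algebra_simps)
  qed
  then have "sum (markov_weight \<delta>) (new_subseqs a (b # w)) \<le> g ^ Suc (length (b # w)) / (1 + \<delta>)"
    by (simp add: B_def)
  then show ?case unfolding g_def .
qed

text \<open>Subsequences are sorted by the position where their rightmost embedding starts, which
  yields a geometric sum. The constant K = 1 / (1 - \<delta>) is the solution of K + g / (1 +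
  \<delta>) = K g.\<close>

lemma sum_markov_weight_subseqs:
  assumes "0 < \<delta>" "\<delta> < 1"
  shows "sum (markov_weight \<delta>) {x. subseq x y} \<le> ((1 + \<delta>) / (2 * \<delta>)) ^ length y / (1 - \<delta>)"
proof (induction y)
  case Nil
  have "{x :: bool list. subseq x []} = {[]}" by auto
  then show ?case using assms by (simp add: markov_weight_def)
next
  case (Cons a w)
  define g where "g = (1 + \<delta>) / (2 * \<delta>)"
  have "{x. subseq x (a # w)} = {x. subseq x w} \<union> new_subseqs a w"
    by (auto simp: new_subseqs_def)
  then have "sum (markov_weight \<delta>) {x. subseq x (a # w)}
      = sum (markov_weight \<delta>) {x. subseq x w} + sum (markov_weight \<delta>) (new_subseqs a w)"
    by (simp only:) (subst sum.union_disjoint, auto simp: new_subseqs_def[of a w])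
  also have "\<dots> \<le> g ^ length w / (1 - \<delta>) + g ^ Suc (length w) / (1 + \<delta>)"
    using Cons sum_markov_weight_new_subseqs[OF assms, of a w] unfolding g_def by (rule add_mono)
  also have "\<dots> = g ^ length w * (1 / (1 - \<delta>) + g / (1 + \<delta>))" by (simp add: algebra_simps)
  also have "1 / (1 - \<delta>) + g / (1 + \<delta>) = g / (1 - \<delta>)"
  proof -
    have "1 / (1 - \<delta>) + 1 / (2 * \<delta>) = (1 + \<delta>) / (2 * \<delta> * (1 - \<delta>))"
      using assms by (simp add: divide_simps)
    then show ?thesis using assms by (simp add: g_def)
  qed
  finally have "sum (markov_weight \<delta>) {x. subseq x (a # w)} \<le> g ^ Suc (length w) / (1 - \<delta>)"
    by (simp add: mult.commute)
  then show ?case unfolding g_def by simp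
qed

text \<open>Matches the capacity with what each codeword letter contributes: \<delta> for removing
  the weight, and the growth factor of the previous bounds for 1 + \<delta> letters of
  \<open>y\<close>.\<close>

lemma two_powr_capacity:
  assumes "0 < \<delta>"
  shows "2 powr (- (1 + \<delta> - ins_entropy \<delta>)) = \<delta> * ((1 + \<delta>) / (2 * \<delta>)) powr (1 + \<delta>)"
proof -
  have "log 2 (\<delta> * ((1 + \<delta>) / (2 * \<delta>)) powr (1 + \<delta>))
      = log 2 \<delta> + (1 + \<delta>) * (log 2 (1 + \<delta>) - (1 + log 2 \<delta>))"
    using assms by (simp add: log_mult log_powr log_divide)
  also have "\<dots> = - (1 + \<delta> - ins_entropy \<delta>)"
    by (simp add: ins_entropy_def algebra_simps)
  finally have "2 powr (- (1 + \<delta> - ins_entropy \<delta>))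
      = 2 powr (log 2 (\<delta> * ((1 + \<delta>) / (2 * \<delta>)) powr (1 + \<delta>)))" by simp
  also have "\<dots> = \<delta> * ((1 + \<delta>) / (2 * \<delta>)) powr (1 + \<delta>)"
    using assms by (intro powr_log_cancel) auto
  finally show ?thesis .
qed

text \<open>A Chernoff-type argument: the weight tilts the measure by (1 / \<delta>) ^ length, and
  the restriction to words of length \<open>n\<close> is then dropped.\<close>

lemma markov_subseqs_le:
  assumes "0 < \<delta>" "\<delta> < 1" and y: "real (length y) \<le> (1 + \<delta>) * n"
  shows "(\<Sum>x | x \<in> binary_words n \<and> subseq x y. markov ((1 + \<delta>) / 2) x)
     \<le> 2 powr (- (1 + \<delta> - ins_entropy \<delta>) * n) / (1 - \<delta>)"
proof -
  define g where "g = (1 + \<delta>) / (2 * \<delta>)"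
  have g: "1 \<le> g" using assms by (simp add: g_def)
  have "(\<Sum>x | x \<in> binary_words n \<and> subseq x y. markov ((1 + \<delta>) / 2) x)
      = (\<Sum>x | x \<in> binary_words n \<and> subseq x y. \<delta> ^ n * markov_weight \<delta> x)"
    using assms by (intro sum.cong) (auto simp: markov_weight_def binary_words_def)
  also have "\<dots> = \<delta> ^ n * (\<Sum>x | x \<in> binary_words n \<and> subseq x y. markov_weight \<delta> x)"
    by (simp add: sum_distrib_left)
  also have "\<dots> \<le> \<delta> ^ n * (\<Sum>x | subseq x y. markov_weight \<delta> x)"
    using assms by (intro mult_left_mono sum_mono2) (auto intro: markov_weight_nonneg)
  also have "\<dots> \<le> \<delta> ^ n * (g ^ length y / (1 - \<delta>))"
    using sum_markov_weight_subseqs[OF assms(1,2), of y] assms unfolding g_def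
    by (intro mult_left_mono) auto
  also have "g ^ length y \<le> g powr ((1 + \<delta>) * n)"
    using powr_mono[OF y g] g by (simp add: powr_realpow)
  also have "\<delta> ^ n * (g powr ((1 + \<delta>) * n) / (1 - \<delta>)) = (\<delta> * g powr (1 + \<delta>)) ^ n / (1 - \<delta>)"
    using g by (simp add: power_mult_distrib powr_powr[symmetric] powr_realpow)
  also have "\<delta> * g powr (1 + \<delta>) = 2 powr (- (1 + \<delta> - ins_entropy \<delta>))"
    unfolding g_def using two_powr_capacity assms by simp
  also have "\<dots> ^ n = 2 powr (- (1 + \<delta> - ins_entropy \<delta>) * n)"
    by (simp only: powr_powr[symmetric] powr_realpow[OF powr_gt_zero[THEN iffD2]])
  finally show ?thesis using assms by (simp add: divide_right_mono)
qed

subsection \<open>Greedy selection of a code\<close>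

lemma exists_code_potential:
  fixes \<mu> :: "'a \<Rightarrow> real" and v m \<beta> :: real and P :: "'a \<Rightarrow> 'b \<Rightarrow> bool"
  assumes fin: "finite X" "finite Y" and nn: "\<And>x. x \<in> X \<Longrightarrow> 0 \<le> \<mu> x" and one: "sum \<mu> X = 1"
    and v: "\<And>y. y \<in> Y \<Longrightarrow> sum \<mu> {x \<in> X. P x y} \<le> v" "0 \<le> v"
    and m: "\<And>x. x \<in> X \<Longrightarrow> \<mu> x \<le> m" "real M * m \<le> 1 / 2" "0 \<le> m"
    and \<beta>: "0 \<le> \<beta>"
  shows "\<exists>C\<subseteq>X. card C = M \<and>
    (\<Sum>y\<in>Y. (1 + \<beta>) ^ card {c \<in> C. P c y}) \<le> card Y * (1 + 2 * \<beta> * v) ^ M"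
  using m(2)
proof (induction M)
  case 0
  show ?case by (intro exI[of _ "{}"]) auto
next
  case (Suc k)
  have km: "real k * m \<le> 1 / 2" using Suc.prems m(3) by (simp add: algebra_simps)
  then obtain C where C: "C \<subseteq> X" "card C = k"
    and pot: "(\<Sum>y\<in>Y. (1 + \<beta>) ^ card {c \<in> C. P c y}) \<le> card Y * (1 + 2 * \<beta> * v) ^ k"
    using Suc.IH by blast
  have finC: "finite C" using C fin finite_subset by blast
  define f where "f y = (1 + \<beta>) ^ card {c \<in> C. P c y}" for y
  define \<Phi> where "\<Phi> = sum f Y"
  have f0: "0 \<le> f y" for y using \<beta> by (simp add: f_def)
  have \<Phi>0: "0 \<le> \<Phi>" unfolding \<Phi>_def by (intro sum_nonneg f0)
  define T where "T x = sum f {y \<in> Y. P x y}" for x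
  have T0: "0 \<le> T x" for x unfolding T_def by (intro sum_nonneg f0)
  have "sum \<mu> C \<le> (\<Sum>x\<in>C. m)" using m C by (intro sum_mono) auto
  then have "sum \<mu> C \<le> 1 / 2" using km C by simp
  then have rest: "sum \<mu> (X - C) \<ge> 1 / 2" using sum_diff[OF fin(1) C(1), of \<mu>] one by simp
  have "(\<Sum>x\<in>X. \<mu> x * T x) = (\<Sum>x\<in>X. \<Sum>y | y \<in> Y \<and> P x y. \<mu> x * f y)"
    by (simp add: T_def sum_distrib_left)
  also have "\<dots> = (\<Sum>y\<in>Y. \<Sum>x | x \<in> X \<and> P x y. \<mu> x * f y)"
    using fin by (intro sum.swap_restrict)
  also have "\<dots> = (\<Sum>y\<in>Y. sum \<mu> {x \<in> X. P x y} * f y)" by (simp add: sum_distrib_right)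
  also have "\<dots> \<le> (\<Sum>y\<in>Y. v * f y)" using v f0 by (intro sum_mono mult_right_mono) auto
  also have "\<dots> = v * \<Phi>" by (simp add: \<Phi>_def sum_distrib_left)
  finally have avg: "(\<Sum>x\<in>X. \<mu> x * T x) \<le> v * \<Phi>" .
  have "\<exists>x\<in>X - C. T x \<le> 2 * v * \<Phi>"
  proof (rule ccontr)
    assume "\<not> ?thesis"
    then have gt: "2 * v * \<Phi> < T x" if "x \<in> X - C" for x using that by force
    \<comment> \<open>A point of positive mass makes the comparison of the averages strict, even if
      \<open>v\<close> or \<open>\<Phi>\<close> vanishes.\<close>
    obtain z where z: "z \<in> X - C" "\<mu> z \<noteq> 0"
      using rest sum.neutral[of "X - C" \<mu>] by fastforce
    have "(\<Sum>x\<in>X - C. \<mu> x * (2 * v * \<Phi>)) < (\<Sum>x\<in>X - C. \<mu> x * T x)"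
    proof (rule sum_strict_mono_ex1)
      show "\<forall>x\<in>X - C. \<mu> x * (2 * v * \<Phi>) \<le> \<mu> x * T x"
        using gt nn by (intro ballI mult_left_mono) (auto intro: less_imp_le)
      have "\<mu> z > 0" using z nn[of z] by auto
      then show "\<exists>x\<in>X - C. \<mu> x * (2 * v * \<Phi>) < \<mu> x * T x"
        using mult_strict_left_mono[OF gt[OF z(1)]] z(1) by blast
    qed (use fin in auto)
    also have "\<dots> \<le> (\<Sum>x\<in>X. \<mu> x * T x)"
      using fin nn T0 by (intro sum_mono2) auto
    also note avg
    finally have "sum \<mu> (X - C) * (2 * v * \<Phi>) < v * \<Phi>" by (simp add: sum_distrib_right)
    moreover have "1 / 2 * (2 * v * \<Phi>) \<le> sum \<mu> (X - C) * (2 * v * \<Phi>)"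
      using rest v(2) \<Phi>0 by (intro mult_right_mono) auto
    ultimately show False by simp
  qed
  then obtain x where x: "x \<in> X" "x \<notin> C" "T x \<le> 2 * v * \<Phi>" by blast
  have upd: "(1 + \<beta>) ^ card {c \<in> insert x C. P c y} = f y + (if P x y then \<beta> * f y else 0)" for y
  proof (cases "P x y")
    case True
    then have "{c \<in> insert x C. P c y} = insert x {c \<in> C. P c y}" by auto
    then show ?thesis using True x finC by (simp add: f_def algebra_simps)
  next
    case False
    then have "{c \<in> insert x C. P c y} = {c \<in> C. P c y}" by auto
    then show ?thesis using False by (simp add: f_def)
  qed
  have "(\<Sum>y\<in>Y. (1 + \<beta>) ^ card {c \<in> insert x C. P c y}) = \<Phi> + \<beta> * T x"
    unfolding upd using fin
    by (auto simp: sum.distrib \<Phi>_def T_def sum_distrib_left sum.inter_filter intro!: sum.cong)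
  also have "\<dots> \<le> \<Phi> * (1 + 2 * \<beta> * v)"
    using mult_left_mono[OF x(3) \<beta>] by (simp add: algebra_simps)
  also have "\<dots> \<le> (card Y * (1 + 2 * \<beta> * v) ^ k) * (1 + 2 * \<beta> * v)"
    using pot v \<beta> unfolding \<Phi>_def f_def by (intro mult_right_mono) auto
  finally have "(\<Sum>y\<in>Y. (1 + \<beta>) ^ card {c \<in> insert x C. P c y}) \<le> card Y * (1 + 2 * \<beta> * v) ^ Suc k"
    by (simp add: mult_ac)
  moreover have "card (insert x C) = Suc k" using C x finC by simp
  moreover have "insert x C \<subseteq> X" using C x by simp
  ultimately show ?case by blast
qed

subsection \<open>Achievability\<close>

lemma code_of_rateI:
  assumes "C \<subseteq> binary_words n" "0 \<le> R" "R \<le> 1" "card C = nat \<lfloor>2 powr (R * n)\<rfloor>"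
  shows "code_of_rate n R C"
proof -
  have "real (card C) = of_int \<lfloor>2 powr (R * n)\<rfloor>" by (simp add: assms(4) of_nat_nat)
  then show ?thesis using assms unfolding code_of_rate_def by linarith
qed

lemma code_of_rate_exists:
  assumes "0 \<le> R" "R \<le> 1"
  obtains C where "code_of_rate n R C"
proof -
  have "2 powr (R * n) \<le> 2 powr n"
    using assms by (intro powr_mono) (auto intro: mult_left_le_one_le)
  then have "nat \<lfloor>2 powr (R * n)\<rfloor> \<le> 2 ^ n"
    by (simp add: powr_realpow nat_le_iff floor_le_iff)
  then obtain C where "C \<subseteq> binary_words n" "card C = nat \<lfloor>2 powr (R * n)\<rfloor>"
    using obtain_subset_with_card_n[of "nat \<lfloor>2 powr (R * n)\<rfloor>" "binary_words n"]
    by (metis card_binary_words)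
  then show ?thesis using code_of_rateI assms that by blast
qed

lemma list_decodable_ins_card:
  assumes "finite C" "real (card C) \<le> L"
  shows "list_decodable_ins n \<delta> L C"
  unfolding list_decodable_ins_def
proof
  fix y
  have "card {c \<in> C. subseq c y} \<le> card C" using assms by (intro card_mono) auto
  then show "real (card {c \<in> C. subseq c y}) \<le> L" using assms(2) by linarith
qed

lemma code_of_rate_finite: "code_of_rate n R C \<Longrightarrow> finite C"
  unfolding code_of_rate_def using finite_subset finite_binary_words by blast

text \<open>The base of this exponential is \<open>g powr (- \<delta>)\<close>, which is below 1. It
  ensures that the codewords together have mass at most 1/2.\<close>

lemma eventually_markov_small:
  assumes "0 < \<delta>" "\<delta> < 1"
  shows "\<forall>\<^sub>F n in sequentially. 2 powr ((1 + \<delta> - ins_entropy \<delta>) * n) * ((1 + \<delta>) / 2) ^ n \<le> 1 / 2"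
proof -
  define g where "g = (1 + \<delta>) / (2 * \<delta>)"
  have g: "1 < g" using assms by (simp add: g_def)
  have "2 powr (1 + \<delta> - ins_entropy \<delta>) = 1 / (\<delta> * g powr (1 + \<delta>))"
    using two_powr_capacity[OF assms(1)] unfolding g_def powr_minus_divide by (metis div_by_1 divide_divide_eq_right mult_1)
  moreover have "(1 + \<delta>) / 2 = \<delta> * g" using assms by (simp add: g_def)
  moreover have "1 / (\<delta> * g powr (1 + \<delta>)) * (\<delta> * g) = g powr (- \<delta>)"
    using assms g by (simp add: powr_add powr_minus_divide)
  ultimately have "2 powr (1 + \<delta> - ins_entropy \<delta>) * ((1 + \<delta>) / 2) = g powr (- \<delta>)" by simp
  then have eq: "2 powr ((1 + \<delta> - ins_entropy \<delta>) * n) * ((1 + \<delta>) / 2) ^ n = (g powr (- \<delta>)) ^ n" for n :: nat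
    by (metis powr_gt_zero powr_powr powr_realpow power_mult_distrib zero_neq_numeral)
  have "g powr (- \<delta>) < 1" using g assms powr_less_mono[of "- \<delta>" 0 g] by simp
  then have "(\<lambda>n. (g powr (- \<delta>)) ^ n) \<longlonglongrightarrow> 0" by (intro LIMSEQ_power_zero) simp
  from order_tendstoD(2)[OF this, of "1 / 2"] show ?thesis
    unfolding eq by (auto elim: eventually_mono)
qed

text \<open>The choice of \<beta> keeps M \<beta> v at most \<open>D\<close>, uniformly in
  \<open>n\<close>. The potential is then at most 2^N e^(2 D), and taking logarithms bounds the
  exponent \<open>l\<close> by a multiple of n / (\<epsilon> n).\<close>

lemma list_size_le:
  fixes l n N M :: nat and c D \<epsilon> :: real
  assumes "0 < D" "0 < \<epsilon>" "0 < n" "N \<le> 2 * n"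
    and M: "real M \<le> 2 powr ((c - \<epsilon>) * n)"
    and l: "(1 + 2 powr (\<epsilon> * n)) ^ l
      \<le> 2 ^ N * (1 + 2 * 2 powr (\<epsilon> * n) * (2 powr (- c * n) * D)) ^ M"
  shows "real l \<le> (2 + 4 * D) / \<epsilon>"
proof -
  define \<beta> where "\<beta> = 2 powr (\<epsilon> * n)"
  define v where "v = 2 powr (- c * n) * D"
  have \<beta>: "\<beta> > 0" by (simp add: \<beta>_def)
  have v: "v > 0" using assms(1) by (simp add: v_def)
  have b: "0 < 1 + 2 * \<beta> * v" using \<beta> v by (simp add: add_pos_pos)
  have "M * (\<beta> * v) \<le> 2 powr ((c - \<epsilon>) * n) * (\<beta> * v)"
    using M \<beta> v by (intro mult_right_mono) auto
  also have "\<dots> = 2 powr ((c - \<epsilon>) * n + \<epsilon> * n + - c * n) * D"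
    unfolding \<beta>_def v_def powr_add by simp
  also have "(c - \<epsilon>) * n + \<epsilon> * n + - c * n = 0" by (simp add: algebra_simps)
  finally have D: "M * (\<beta> * v) \<le> D" by simp
  have "\<epsilon> * n * ln 2 = ln \<beta>" by (simp add: \<beta>_def ln_powr)
  also have "\<dots> \<le> ln (1 + \<beta>)" using \<beta> by simp
  finally have "l * (\<epsilon> * n * ln 2) \<le> l * ln (1 + \<beta>)" by (intro mult_left_mono) auto
  also have "\<dots> = ln ((1 + \<beta>) ^ l)" using \<beta> by (simp add: ln_realpow)
  also have "\<dots> \<le> ln (2 ^ N * (1 + 2 * \<beta> * v) ^ M)"
    using l \<beta> b unfolding \<beta>_def v_def by (subst ln_le_cancel_iff) (auto intro!: mult_pos_pos zero_less_power add_pos_pos)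
  also have "\<dots> = N * ln 2 + M * ln (1 + 2 * \<beta> * v)"
    using b by (simp add: ln_mult ln_realpow)
  also have "\<dots> \<le> N * ln 2 + M * (2 * \<beta> * v)"
    using b \<beta> v ln_add_one_self_le_self[of "2 * \<beta> * v"] by (intro add_mono mult_left_mono) auto
  also have "\<dots> \<le> 2 * n * ln 2 + 2 * D"
    using D assms(4) by (intro add_mono mult_right_mono) (auto simp: mult_ac)
  \<comment> \<open>Since ln 2 is at least 1/2 and \<open>n\<close> at least 1, the constant
    \<open>2 * D\<close> is absorbed into a term linear in \<open>n\<close>.\<close>
  also have "\<dots> \<le> (2 * n + 4 * D * n) * ln 2"
  proof -
    have "1 \<le> n * (2 * ln 2 :: real)"
      using ln_le_minus_one[of "1 / 2"] assms(3) mult_mono[of 1 "real n" 1 "2 * ln 2 :: real"] by (simp add: ln_div)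
    from mult_left_mono[OF this, of "2 * D"] show ?thesis
      using assms(1) by (simp add: algebra_simps)
  qed
  finally have "(l * \<epsilon>) * (n * ln 2) \<le> (2 + 4 * D) * (n * ln 2)" by (simp add: algebra_simps)
  then have "l * \<epsilon> \<le> 2 + 4 * D" using assms(3) by (subst (asm) mult_le_cancel_right_pos) auto
  then show ?thesis using assms(2) by (simp add: pos_le_divide_eq)
qed

text \<open>Greedy selection under the Markov measure. The summands of the potential are
  nonnegative, so its bound applies to the list of every single \<open>y\<close>.\<close>

lemma list_decodable_code_exists_interior:
  assumes \<delta>: "0 < \<delta>" "\<delta> < 1" and \<epsilon>: "0 < \<epsilon>"
    and R: "0 \<le> 1 + \<delta> - ins_entropy \<delta> - \<epsilon>" "1 + \<delta> - ins_entropy \<delta> - \<epsilon> \<le> 1"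
    and n: "0 < n" "2 powr ((1 + \<delta> - ins_entropy \<delta>) * n) * ((1 + \<delta>) / 2) ^ n \<le> 1 / 2"
  shows "\<exists>C. code_of_rate n (1 + \<delta> - ins_entropy \<delta> - \<epsilon>) C \<and>
    list_decodable_ins n \<delta> ((2 + 4 * (1 / (1 - \<delta>))) / \<epsilon>) C"
proof -
  define c where "c = 1 + \<delta> - ins_entropy \<delta>"
  define N where "N = nat \<lfloor>(1 + \<delta>) * real n\<rfloor>"
  define M where "M = nat \<lfloor>2 powr ((c - \<epsilon>) * n)\<rfloor>"
  define s where "s = (1 + \<delta>) / 2"
  define v where "v = 2 powr (- c * n) * (1 / (1 - \<delta>))"
  have s: "1 / 2 \<le> s" "s \<le> 1" using \<delta> by (auto simp: s_def)
  have N: "N \<le> (1 + \<delta>) * n" using \<delta> unfolding N_def by (simp add: of_nat_nat)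
  also have "\<dots> \<le> 2 * real n" using \<delta> by (intro mult_right_mono) auto
  finally have N2: "N \<le> 2 * n" by linarith
  have M: "M \<le> 2 powr ((c - \<epsilon>) * n)" unfolding M_def by (simp add: of_nat_nat)
  have "real M * s ^ n \<le> 2 powr (c * n) * s ^ n"
  proof (rule mult_right_mono)
    have "2 powr ((c - \<epsilon>) * n) \<le> 2 powr (c * n)"
      using \<epsilon> by (intro powr_mono mult_right_mono) auto
    then show "M \<le> 2 powr (c * n)" using M by linarith
  qed (use s in auto)
  then have Ms: "real M * s ^ n \<le> 1 / 2" using n(2) unfolding c_def s_def by linarith
  have "\<exists>C\<subseteq>binary_words n. card C = M \<and>
      (\<Sum>y\<in>binary_words N. (1 + 2 powr (\<epsilon> * n)) ^ card {c \<in> C. subseq c y})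
        \<le> card (binary_words N) * (1 + 2 * 2 powr (\<epsilon> * n) * v) ^ M"
  proof (rule exists_code_potential[where \<mu> = "markov s" and m = "s ^ n"])
    fix y assume "y \<in> binary_words N"
    then have "length y \<le> (1 + \<delta>) * n" using N by (simp add: binary_words_def)
    from markov_subseqs_le[OF \<delta> this]
    show "sum (markov s) {x \<in> binary_words n. subseq x y} \<le> v"
      by (simp add: s_def v_def c_def)
  next
    fix x assume "x \<in> binary_words n"
    then show "markov s x \<le> s ^ n"
      using markov_le_power[OF s, of x] by (simp add: binary_words_def)
  qed (use s \<delta> Ms in \<open>auto simp: sum_markov v_def intro: markov_nonneg\<close>)
  then obtain C where C: "C \<subseteq> binary_words n" "card C = M"
    and pot: "(\<Sum>y\<in>binary_words N. (1 + 2 powr (\<epsilon> * n)) ^ card {c \<in> C. subseq c y})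
        \<le> card (binary_words N) * (1 + 2 * 2 powr (\<epsilon> * n) * v) ^ M" by blast
  have "list_decodable_ins n \<delta> ((2 + 4 * (1 / (1 - \<delta>))) / \<epsilon>) C"
    unfolding list_decodable_ins_def N_def[symmetric]
  proof
    fix y assume y: "y \<in> binary_words N"
    have "(1 + 2 powr (\<epsilon> * n)) ^ card {c \<in> C. subseq c y}
        \<le> (\<Sum>y\<in>binary_words N. (1 + 2 powr (\<epsilon> * n)) ^ card {c \<in> C. subseq c y})"
      using y by (intro member_le_sum) (auto intro: add_nonneg_nonneg)
    also note pot
    finally have pow: "(1 + 2 powr (\<epsilon> * n)) ^ card {c \<in> C. subseq c y}
        \<le> 2 ^ N * (1 + 2 * 2 powr (\<epsilon> * n) * (2 powr (- c * n) * (1 / (1 - \<delta>)))) ^ M"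
      by (simp add: card_binary_words v_def)
    then show "real (card {c \<in> C. subseq c y}) \<le> (2 + 4 * (1 / (1 - \<delta>))) / \<epsilon>"
      using list_size_le[OF _ \<epsilon> n(1) N2 M pow] \<delta> by simp
  qed
  moreover have "code_of_rate n (c - \<epsilon>) C"
    using C R unfolding M_def by (intro code_of_rateI) (auto simp: c_def)
  ultimately show ?thesis unfolding c_def by blast
qed

lemma list_decodable_code_exists:
  assumes \<delta>: "0 \<le> \<delta>" "\<delta> \<le> 1"
  shows "\<exists>K :: real. \<forall>\<epsilon> > 0. 0 \<le> 1 + \<delta> - ins_entropy \<delta> - \<epsilon> \<and> 1 + \<delta> - ins_entropy \<delta> - \<epsilon> \<le> 1 \<longrightarrow>
    (\<forall>n. \<exists>C. code_of_rate n (1 + \<delta> - ins_entropy \<delta> - \<epsilon>) C \<and> list_decodable_ins n \<delta> (K / \<epsilon>) C)"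
proof -
  consider "\<delta> = 0" | "\<delta> = 1" | "0 < \<delta>" "\<delta> < 1" using assms by linarith
  then show ?thesis
  proof cases
    case 1
    \<comment> \<open>Without insertions \<open>y\<close> has length \<open>n\<close> and contains
      no codeword except possibly itself.\<close>
    have "\<exists>C. code_of_rate n (1 - \<epsilon>) C \<and> list_decodable_ins n 0 (1 / \<epsilon>) C"
      if \<epsilon>: "0 < \<epsilon>" "0 \<le> 1 - \<epsilon>" for \<epsilon> :: real and n
    proof -
      obtain C where C: "code_of_rate n (1 - \<epsilon>) C" using code_of_rate_exists[of "1 - \<epsilon>"] \<epsilon> by auto
      have "list_decodable_ins n 0 (1 / \<epsilon>) C" unfolding list_decodable_ins_def
      proof
        fix y assume "y \<in> binary_words (nat \<lfloor>(1 + 0) * real n\<rfloor>)"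
        then have "{c \<in> C. subseq c y} \<subseteq> {y}"
          using C by (auto simp: code_of_rate_def binary_words_def subset_eq intro: subseq_same_length)
        then have "card {c \<in> C. subseq c y} \<le> 1" using card_mono[of "{y}"] by fastforce
        moreover have "1 \<le> 1 / \<epsilon>" using \<epsilon> by simp
        ultimately show "real (card {c \<in> C. subseq c y}) \<le> 1 / \<epsilon>" by linarith
      qed
      with C show ?thesis by blast
    qed
    then show ?thesis using 1 by (intro exI[of _ 1]) (auto simp: ins_entropy_def)
  next
    case 2
    \<comment> \<open>At \<delta> = 1 the capacity is 0, so no admissible \<epsilon> exists.\<close>
    then show ?thesis by (intro exI[of _ 0]) (auto simp: ins_entropy_def)
  next
    case 3
    obtain n0 where n0: "\<And>n. n \<ge> n0 \<Longrightarrow>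
        2 powr ((1 + \<delta> - ins_entropy \<delta>) * n) * ((1 + \<delta>) / 2) ^ n \<le> 1 / 2"
      using eventually_markov_small[OF 3] by (auto simp: eventually_sequentially)
    define D where "D = 2 + 4 * (1 / (1 - \<delta>))"
    have D: "D > 0" using 3 by (simp add: D_def add_pos_pos)
    \<comment> \<open>The summand \<open>2 ^ n0\<close> covers the short block lengths: there every
      code has at most \<open>2 ^ n0\<close> words, and dividing by \<epsilon> does no harm as
      \<epsilon> is at most 1.\<close>
    have "\<exists>C. code_of_rate n (1 + \<delta> - ins_entropy \<delta> - \<epsilon>) C \<and>
        list_decodable_ins n \<delta> ((2 ^ n0 + D) / \<epsilon>) C"
      if \<epsilon>: "0 < \<epsilon>" "0 \<le> 1 + \<delta> - ins_entropy \<delta> - \<epsilon>" "1 + \<delta> - ins_entropy \<delta> - \<epsilon> \<le> 1" for \<epsilon> n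
    proof (cases "n0 \<le> n \<and> 0 < n")
      case True
      then obtain C where C: "code_of_rate n (1 + \<delta> - ins_entropy \<delta> - \<epsilon>) C"
        "list_decodable_ins n \<delta> (D / \<epsilon>) C"
        using list_decodable_code_exists_interior[OF 3 \<epsilon>] n0 unfolding D_def by blast
      have "D / \<epsilon> \<le> (2 ^ n0 + D) / \<epsilon>" using \<epsilon> by (intro divide_right_mono) auto
      then have "list_decodable_ins n \<delta> ((2 ^ n0 + D) / \<epsilon>) C"
        using C(2) unfolding list_decodable_ins_def by fastforce
      with C show ?thesis by blast
    next
      case False
      then have n: "n \<le> n0" by auto
      obtain C where C: "code_of_rate n (1 + \<delta> - ins_entropy \<delta> - \<epsilon>) C"
        using code_of_rate_exists \<epsilon> by blast
      have "\<epsilon> \<le> 1" using \<epsilon> ins_entropy_ge[OF assms] by linarith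
      have "card C \<le> 2 ^ n"
        using C card_mono[of "binary_words n" C] by (auto simp: code_of_rate_def card_binary_words)
      also have "\<dots> \<le> 2 ^ n0" using n by (intro power_increasing) auto
      finally have "real (card C) \<le> 2 ^ n0"
        using of_nat_le_iff[where 'a = real, of "card C" "2 ^ n0"] by simp
      also have "\<dots> \<le> (2 ^ n0 + D) * 1" using D by simp
      also have "\<dots> \<le> (2 ^ n0 + D) * (1 / \<epsilon>)"
        using D \<epsilon> \<open>\<epsilon> \<le> 1\<close> by (intro mult_left_mono) auto
      finally have "real (card C) \<le> (2 ^ n0 + D) / \<epsilon>" by simp
      then show ?thesis using C list_decodable_ins_card code_of_rate_finite by blast
    qed
    then show ?thesis by blast
  qed
qed

subsection \<open>The capacity\<close>

lemma achievable_ins_less: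
  assumes \<delta>: "0 \<le> \<delta>" "\<delta> \<le> 1" and R: "R < 1 + \<delta> - ins_entropy \<delta>"
  shows "achievable_ins \<delta> R"
proof (cases "0 \<le> R")
  case True
  define \<epsilon> where "\<epsilon> = 1 + \<delta> - ins_entropy \<delta> - R"
  have "0 < \<epsilon>" "R \<le> 1" using R ins_entropy_ge[OF \<delta>] by (auto simp: \<epsilon>_def)
  moreover have "R = 1 + \<delta> - ins_entropy \<delta> - \<epsilon>" by (simp add: \<epsilon>_def)
  ultimately obtain K where "\<forall>n. \<exists>C. code_of_rate n R C \<and> list_decodable_ins n \<delta> (K / \<epsilon>) C"
    using list_decodable_code_exists[OF \<delta>] True by metis
  then show ?thesis unfolding achievable_ins_def
    by (intro exI[of _ "\<lambda>_. K / \<epsilon>"] conjI exI[of _ 0] always_eventually)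
       (auto, meson order_refl)
next
  case False
  \<comment> \<open>A negative rate is served by a code of rate 0, which has at most one
    word.\<close>
  have "\<exists>C. code_of_rate n 0 C \<and> list_decodable_ins n \<delta> 1 C" for n
  proof -
    obtain C where C: "code_of_rate n 0 C" using code_of_rate_exists[of 0] by auto
    then have "\<bar>real (card C) - 1\<bar> < 1" by (auto simp: code_of_rate_def)
    then have "real (card C) < 2" by linarith
    then have "real (card C) \<le> 1" by simp
    with C show ?thesis using list_decodable_ins_card code_of_rate_finite by blast
  qed
  then show ?thesis using False unfolding achievable_ins_def
    by (intro exI[of _ "\<lambda>_. 1"] conjI exI[of _ 0] always_eventually)
       (auto, meson linorder_le_cases)
qed

text \<open>A polynomial list size eventually falls below
  \<open>2 powr (\<epsilon> * n / 2)\<close>, where the converse applies to every rate at least the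
  given one.\<close>

lemma not_achievable_ins:
  assumes \<delta>: "0 \<le> \<delta>" "\<delta> \<le> 1" and \<epsilon>: "0 < \<epsilon>"
  shows "\<not> achievable_ins \<delta> (1 + \<delta> - ins_entropy \<delta> + \<epsilon>)"
proof
  assume "achievable_ins \<delta> (1 + \<delta> - ins_entropy \<delta> + \<epsilon>)"
  then obtain L k where L: "L \<in> O(\<lambda>n. real n ^ k)" and
    codes: "\<forall>\<^sub>F n in sequentially. \<exists>C. (\<exists>R' \<ge> 1 + \<delta> - ins_entropy \<delta> + \<epsilon>. code_of_rate n R' C)
      \<and> list_decodable_ins n \<delta> (L n) C"
    unfolding achievable_ins_def by blast
  from L obtain a where a: "a > 0" "\<forall>\<^sub>F n in sequentially. norm (L n) \<le> a * norm (real n ^ k)"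
    by (auto elim: landau_o.bigE)
  have "\<forall>\<^sub>F n in sequentially. a * real n ^ k \<le> 2 powr (\<epsilon> * real n / 2)"
    using a(1) \<epsilon> by real_asymp
  with a(2) codes converse_ins[OF \<delta> \<epsilon>] have "\<forall>\<^sub>F n in sequentially. False"
  proof eventually_elim
    case (elim n)
    then obtain C R' where C: "1 + \<delta> - ins_entropy \<delta> + \<epsilon> \<le> R'" "code_of_rate n R' C"
      "list_decodable_ins n \<delta> (L n) C" by blast
    have "L n \<le> 2 powr (\<epsilon> * real n / 2)" using elim by simp
    then have "list_decodable_ins n \<delta> (2 powr (\<epsilon> * real n / 2)) C"
      using C(3) unfolding list_decodable_ins_def by fastforce
    moreover have "C \<subseteq> binary_words n" using C(2) by (simp add: code_of_rate_def)
    ultimately show False using elim code_of_rate_card_ge[OF C(2,1)] by blast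
  qed
  then show False by simp
qed

lemma C_ins_eq:
  assumes "0 \<le> \<delta>" "\<delta> \<le> 1"
  shows "C_ins \<delta> = 1 + \<delta> - ins_entropy \<delta>"
  unfolding C_ins_def
proof (rule Greatest_equality)
  show "\<forall>R < 1 + \<delta> - ins_entropy \<delta>. achievable_ins \<delta> R"
    using achievable_ins_less[OF assms] by blast
next
  fix c assume c: "\<forall>R < c. achievable_ins \<delta> R"
  show "c \<le> 1 + \<delta> - ins_entropy \<delta>"
  proof (rule ccontr)
    assume "\<not> ?thesis"
    \<comment> \<open>Achievability is only known for rates strictly below \<open>c\<close>, so a
      rate strictly between the two values is needed.\<close>
    then obtain R where "1 + \<delta> - ins_entropy \<delta> < R" "R < c" using dense by (metis not_le)
    then show False
      using c not_achievable_ins[OF assms, of "R - (1 + \<delta> - ins_entropy \<delta>)"] by simp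
  qed
qed

theorem theorem1p1:
  fixes \<delta> :: real
  assumes "0 \<le> \<delta>" and "\<delta> \<le> 1"
  shows "C_ins \<delta> = (1 + \<delta>) * (1 - binary_entropy (\<delta> / (1 + \<delta>))) \<and>
    (\<exists>K :: real. \<forall>\<epsilon> > 0. 0 \<le> C_ins \<delta> - \<epsilon> \<and> C_ins \<delta> - \<epsilon> \<le> 1 \<longrightarrow>
       (\<forall>n. \<exists>C. code_of_rate n (C_ins \<delta> - \<epsilon>) C \<and> list_decodable_ins n \<delta> (K / \<epsilon>) C)) \<and>
    (\<forall>\<epsilon> > 0. \<forall>\<^sub>F n in sequentially. \<forall>C. code_of_rate n (C_ins \<delta> + \<epsilon>) C \<longrightarrow>
       \<not> list_decodable_ins n \<delta> (2 powr (\<epsilon> * real n / 2)) C)"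
proof (intro conjI)
  show "C_ins \<delta> = (1 + \<delta>) * (1 - binary_entropy (\<delta> / (1 + \<delta>)))"
    using C_ins_eq[OF assms] capacity_eq[OF assms(1)] by simp
  show "\<exists>K :: real. \<forall>\<epsilon> > 0. 0 \<le> C_ins \<delta> - \<epsilon> \<and> C_ins \<delta> - \<epsilon> \<le> 1 \<longrightarrow>
       (\<forall>n. \<exists>C. code_of_rate n (C_ins \<delta> - \<epsilon>) C \<and> list_decodable_ins n \<delta> (K / \<epsilon>) C)"
    unfolding C_ins_eq[OF assms] by (rule list_decodable_code_exists[OF assms])
  show "\<forall>\<epsilon> > 0. \<forall>\<^sub>F n in sequentially. \<forall>C. code_of_rate n (C_ins \<delta> + \<epsilon>) C \<longrightarrow>
       \<not> list_decodable_ins n \<delta> (2 powr (\<epsilon> * real n / 2)) C"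
    unfolding C_ins_eq[OF assms]
  proof (intro allI impI)
    fix \<epsilon> :: real assume "0 < \<epsilon>"
    from converse_ins[OF assms this]
    show "\<forall>\<^sub>F n in sequentially. \<forall>C. code_of_rate n (1 + \<delta> - ins_entropy \<delta> + \<epsilon>) C \<longrightarrow>
       \<not> list_decodable_ins n \<delta> (2 powr (\<epsilon> * real n / 2)) C"
    proof eventually_elim
      case (elim n)
      then show ?case using code_of_rate_card_ge[OF _ order_refl] unfolding code_of_rate_def by blast
    qed
  qed
qed

end
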